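(* Let $n\ge1$, $l\in\{0,\dots,2n\}$, $k\ge0$, let $t_1,\dots,t_k$ be positive even integers and $p_0,\dots,p_k\ge0$ integers, with $t=\sum_{j=0}^kp_j+\sum_{j=1}^kt_j\in\{1,\dots,n\}$, $t\le\min\{l,2n-l\}$ and $l-t$ even. Let $$\mathbf a=X^{(0)}\mathbf A_1X^{(1)}\cdots X^{(k-1)}\mathbf A_kX^{(k)}\in SpT_{2n}(\varpi_t),$$ where $X^{(i)}=(x^{(i)}_1)\cdots(x^{(i)}_{p_i})$ for $0\le i\le k$, $\ \mathbf s(X^{(0)}X^{(1)}\cdots X^{(k)})\cap\mathbf a=\emptyset$, and the $\mathbf A_i=(a_i,a_i+1,\dots,a_i+t_i-1)$, $a_i$ odd, $1\le i\le k$, are the maximal nonempty intervals in $\mathbf a$ with $\mathbf s(\mathbf A_i)=\mathbf A_i$, satisfying $$a_i\ge2t^{(i-1)}+t_i+1,\qquad t^{(i)}:=\sum_{j=1}^{i}t_j+\sum_{j=0}^{i}p_j\quad(\text{so }t^{(0)}=p_0,\ t^{(k)}=t).$$ Use the conventions $t^{(-1)}=t_0=0$, $x^{(0)}_0=0$, and $x^{(i)}_0=a_i+t_i-1$ for $1\le i\le k$. For $i=0,1,\dots,k$ define recursively numbers $\tilde l_{i+1}$ and $l_{t^{(i-1)}+t_i+j+1}$, $0\le j\le p_i$, as follows. Put $S_i=\sum_{r=0}^{i-1}\ \sum_{m=t^{(r-1)}+t_r+1}^{t^{(r)}+1}l_m$ (so $S_0=0$) and $$\tilde l_{i+1}=\min\Big(\big\{a_j-2t^{(j-1)}-t_j-1-S_i:\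 i+1\le j\le k\big\}\cup\big\{l-t-S_i\big\}\Big)$$ (in particular $\tilde l_{k+1}=l-t-S_k$). If $p_i\ge1$, put $$l_{t^{(i-1)}+t_i+1}=\begin{cases}\min\{x^{(i)}_1-x^{(i)}_0-2,\ \tilde l_{i+1}\},&x^{(i)}_1\text{ even}\\ \min\{x^{(i)}_1-x^{(i)}_0-1,\ \tilde l_{i+1}\},&x^{(i)}_1\text{ odd;}\end{cases}$$ for $1\le j<p_i$, with $R_{i,j}=\tilde l_{i+1}-\sum_{m=1}^{j}l_{t^{(i-1)}+t_i+m}$, $$l_{t^{(i-1)}+t_i+j+1}=\begin{cases}\min\{x^{(i)}_{j+1}-x^{(i)}_j-2,\ R_{i,j}\},&x^{(i)}_j,x^{(i)}_{j+1}\text{ both even or both odd}\\ \min\{x^{(i)}_{j+1}-x^{(i)}_j-1,\ R_{i,j}\},&x^{(i)}_j\text{ even},\ x^{(i)}_{j+1}\text{ odd}\\ \min\{x^{(i)}_{j+1}-x^{(i)}_j-3,\ R_{i,j}\},&x^{(i)}_j\text{ odd},\ x^{(i)}_{j+1}\text{ even;}\end{cases}$$ and finally (for any $p_i\ge0$) $$l_{t^{(i)}+1}=\tilde l_{i+1}-\sum_{m=1}^{p_i}l_{t^{(i-1)}+t_i+m}.$$ Then all the numbers $\tilde l_{i+1}$ and $l_{t^{(i-1)}+t_i+j+1}$ ($0\le i\le k$, $0\le j\le p_i$) are nonnegative and even. Put, for $0\le i\le k$, $$T^{(i)}_0=(x^{(i)}_0+1,\ x^{(i)}_0+2,\dots,x^{(i)}_0+l_{t^{(i-1)}+t_i+1}),$$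 and for $1\le j\le p_i$ $$T^{(i)}_j=\begin{cases}(x^{(i)}_j+1,\dots,x^{(i)}_j+l_{t^{(i-1)}+t_i+j+1}),&x^{(i)}_j\text{ even}\\ (x^{(i)}_j+1+1,\ x^{(i)}_j+1+2,\dots,x^{(i)}_j+1+l_{t^{(i-1)}+t_i+j+1}),&x^{(i)}_j\text{ odd}\end{cases}$$ (empty if the corresponding $l$ is $0$). Then the concatenation $$T=T^{(0)}_0(x^{(0)}_1)T^{(0)}_1\cdots(x^{(0)}_{p_0})T^{(0)}_{p_0}\,\mathbf A_1\,T^{(1)}_0(x^{(1)}_1)T^{(1)}_1\cdots(x^{(1)}_{p_1})T^{(1)}_{p_1}\cdots\mathbf A_k\,T^{(k)}_0(x^{(k)}_1)T^{(k)}_1\cdots(x^{(k)}_{p_k})T^{(k)}_{p_k}$$ is an element of $SST_{2n}(\varpi_l)$ with $\mathrm{red}(T)=\mathbf a$; that is, $T=\mathrm{red}_t^{-1}(\mathbf a)$ is the unique preimage of $\mathbf a$ in $SST_{2n}(\varpi_l)$ under the reduction map.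
   Context: $SST_{2n}(\varpi_l)$ is the set of columns of length $l$ on the alphabet $\{1,\dots,2n\}$, i.e. strictly increasing sequences $(b_1<\dots<b_l)$ with entries in $\{1,\dots,2n\}$, often identified with the set of entries or with a word. $SpT_{2n}(\varpi_t)\subseteq SST_{2n}(\varpi_t)$ is the subset of symplectic columns: $b_k\ge2k-1$ for all $k$. The parity involution is $\mathbf s(x)=x+1$ for $x$ odd, $\mathbf s(x)=x-1$ for $x$ even, applied elementwise to sets and words. "Maximal nonempty interval with $\mathbf s(\mathbf A)=\mathbf A$" means maximal for inclusion among nonempty sets of consecutive integers $I\subseteq\mathbf a$ with $\mathbf s(I)=I$. For a column $\mathbf b=(b_1,\dots,b_l)$ the removal subword $\mathrm{rem}(\mathbf b)$ is defined recursively: $\mathrm{rem}(\mathbf b)=\emptyset$ if $l\le1$; if $l\ge2$, $b_l$ is even, $b_{l-1}=b_l-1$ and $b_l<2l-|\mathrm{rem}(b_1,\dots,b_{l-2})|-1$, then $\mathrm{rem}(\mathbf b)=\mathrm{rem}(b_1,\dots,b_{l-2})\cup\{b_{l-1},b_l\}$; otherwise $\mathrm{rem}(\mathbf b)=\mathrm{rem}(b_1,\dots,b_{l-1})$. The reduction of $\mathbf b$ is $\mathrm{red}(\mathbf b)=\mathbf b\setminus\mathrm{rem}(\mathbf b)$. It is known (Watanabe) that $\mathrm{red}$ is injective on $SST_{2n}(\varpi_l)$ and takes values in $\bigsqcup_t SpT_{2n}(\varpi_t)$ over $0\le t\le\min\{l,2n-l\}$, $l-t$ even; $\mathrm{red}_t^{-1}(\mathbf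 a)=T$ means $T\in SST_{2n}(\varpi_l)$ and $\mathrm{red}(T)=\mathbf a$. *)

theory Defs
  imports Main
begin

text \<open>Columns are words of integers; the \<open>k\<close>-th entry \<open>b_k\<close> of a column \<open>b\<close> is \<open>b ! (k - 1)\<close>.\<close>

definition SST :: "nat \<Rightarrow> nat \<Rightarrow> int list set" where
  "SST m l = {b. length b = l \<and> sorted_wrt (<) b \<and> set b \<subseteq> {1..int m}}"

definition SpT :: "nat \<Rightarrow> nat \<Rightarrow> int list set" where
  "SpT m t = {b \<in> SST m t. \<forall>k\<in>{1..t}. b ! (k - 1) \<ge> 2 * int k - 1}"

definition parity_inv :: "int \<Rightarrow> int" where
  "parity_inv x = (if odd x then x + 1 else x - 1)"

definition stable_interval :: "int set \<Rightarrow> int set \<Rightarrow> bool" where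
  "stable_interval W I \<longleftrightarrow> I \<noteq> {} \<and> (\<exists>c d. I = {c..d}) \<and> I \<subseteq> W \<and> parity_inv ` I = I"

definition max_stable_intervals :: "int set \<Rightarrow> int set set" where
  "max_stable_intervals W =
     {I. stable_interval W I \<and> (\<forall>J. stable_interval W J \<and> I \<subseteq> J \<longrightarrow> J = I)}"

text \<open>
  The removal subword, as a set of entries. The word \<open>(b_1, \<dots>, b_(l-2))\<close> is
  \<open>take (length b - 2) b\<close>.
\<close>

function rem_set :: "int list \<Rightarrow> int set" where
  "rem_set b =
     (if length b \<le> 1 then {}
      else if even (last b) \<and> b ! (length b - 2) = last b - 1
              \<and> last b < 2 * int (length b) - int (card (rem_set (take (length b - 2) b))) - 1
      then rem_set (take (length b - 2) b) \<union> {b ! (length b - 2), last b}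
      else rem_set (butlast b))"
  by pat_completeness auto
termination by (relation "measure length") auto

declare rem_set.simps [simp del]

definition red :: "int list \<Rightarrow> int list" where
  "red b = filter (\<lambda>y. y \<notin> rem_set b) b"

text \<open>
  Throughout, \<open>t j\<close>, \<open>a j\<close> (for \<open>1 \<le> j \<le> k\<close>), \<open>p i\<close> (for \<open>0 \<le> i \<le> k\<close>) and \<open>x i j\<close>
  (for \<open>0 \<le> i \<le> k\<close> and \<open>1 \<le> j \<le> p i\<close>) stand for \<open>t_j\<close>, \<open>a_j\<close>, \<open>p_i\<close> and \<open>x^(i)_j\<close>.
  The values of these functions at other arguments are never used.
\<close>

text \<open>The partial sums \<open>t^(i)\<close>.\<close>

definition tsum :: "(nat \<Rightarrow> nat) \<Rightarrow> (nat \<Rightarrow> nat) \<Rightarrow> nat \<Rightarrow> nat" where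
  "tsum t p i = (\<Sum>j=1..i. t j) + (\<Sum>j=0..i. p j)"

text \<open>\<open>x^(i)_j\<close> for \<open>0 \<le> j \<le> p i\<close>, including the conventions for \<open>j = 0\<close>.\<close>

definition xpos :: "(nat \<Rightarrow> nat) \<Rightarrow> (nat \<Rightarrow> int) \<Rightarrow> (nat \<Rightarrow> nat \<Rightarrow> int) \<Rightarrow> nat \<Rightarrow> nat \<Rightarrow> int" where
  "xpos t a x i j =
     (if j = 0 then (if i = 0 then 0 else a i + int (t i) - 1) else x i j)"

text \<open>The first argument of the minimum defining \<open>l_m\<close> for \<open>m = t^(i-1) + t_i + j + 1\<close>, \<open>j < p i\<close>.\<close>

definition gap :: "(nat \<Rightarrow> nat) \<Rightarrow> (nat \<Rightarrow> int) \<Rightarrow> (nat \<Rightarrow> nat \<Rightarrow> int) \<Rightarrow> nat \<Rightarrow> nat \<Rightarrow> int" where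
  "gap t a x i j =
     (let u = xpos t a x i j; v = xpos t a x i (j + 1) in
      if j = 0 then (if even v then v - u - 2 else v - u - 1)
      else if even u \<and> even v \<or> odd u \<and> odd v then v - u - 2
      else if even u \<and> odd v then v - u - 1
      else v - u - 3)"

text \<open>
  Given \<open>L\<close>, the value of the number \<open>l~_(i+1)\<close>, \<open>row_len t p a x i L j\<close> is \<open>l_m\<close> for
  \<open>m = t^(i-1) + t_i + j + 1\<close>, \<open>0 \<le> j \<le> p i\<close>. These indices \<open>m\<close> are distinct for distinct pairs
  \<open>(i, j)\<close>, because \<open>t_i > 0\<close>, so the pair replaces \<open>m\<close>. For \<open>j = 0\<close> the remainder
  \<open>R\<close> below is \<open>L\<close>; for \<open>j = p i\<close> it is the value of the last number of the row.
\<close>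

fun row_len :: "(nat \<Rightarrow> nat) \<Rightarrow> (nat \<Rightarrow> nat) \<Rightarrow> (nat \<Rightarrow> int) \<Rightarrow> (nat \<Rightarrow> nat \<Rightarrow> int)
    \<Rightarrow> nat \<Rightarrow> int \<Rightarrow> nat \<Rightarrow> int" where
  "row_len t p a x i L j =
     (let R = L - (\<Sum>m<j. row_len t p a x i L m) in
      if j < p i then min (gap t a x i j) R else R)"

declare row_len.simps [simp del]

text \<open>
  \<open>ltil l k t p a x i\<close> is \<open>l~_(i+1)\<close>; the sum \<open>S\<close> is \<open>S_i\<close>, whose inner sum over
  \<open>m = t^(r-1) + t_r + 1, \<dots>, t^(r) + 1\<close> runs over \<open>0 \<le> j \<le> p r\<close>.
\<close>

fun ltil :: "nat \<Rightarrow> nat \<Rightarrow> (nat \<Rightarrow> nat) \<Rightarrow> (nat \<Rightarrow> nat) \<Rightarrow> (nat \<Rightarrow> int) \<Rightarrow> (nat \<Rightarrow> nat \<Rightarrow> int)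
    \<Rightarrow> nat \<Rightarrow> int" where
  "ltil l k t p a x i =
     (let S = (\<Sum>r<i. \<Sum>j\<le>p r. row_len t p a x r (ltil l k t p a x r) j) in
      Min ((\<lambda>j. a j - 2 * int (tsum t p (j - 1)) - int (t j) - 1 - S) ` {i + 1..k}
           \<union> {int l - int (tsum t p k) - S}))"

declare ltil.simps [simp del]

definition len :: "nat \<Rightarrow> nat \<Rightarrow> (nat \<Rightarrow> nat) \<Rightarrow> (nat \<Rightarrow> nat) \<Rightarrow> (nat \<Rightarrow> int) \<Rightarrow> (nat \<Rightarrow> nat \<Rightarrow> int)
    \<Rightarrow> nat \<Rightarrow> nat \<Rightarrow> int" where
  "len l k t p a x i j = row_len t p a x i (ltil l k t p a x i) j"

definition A_word :: "(nat \<Rightarrow> nat) \<Rightarrow> (nat \<Rightarrow> int) \<Rightarrow> nat \<Rightarrow> int list" where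
  "A_word t a i = [a i .. a i + int (t i) - 1]"

definition X_word :: "(nat \<Rightarrow> nat) \<Rightarrow> (nat \<Rightarrow> nat \<Rightarrow> int) \<Rightarrow> nat \<Rightarrow> int list" where
  "X_word p x i = map (x i) [1..<p i + 1]"

definition a_word :: "nat \<Rightarrow> (nat \<Rightarrow> nat) \<Rightarrow> (nat \<Rightarrow> nat) \<Rightarrow> (nat \<Rightarrow> int) \<Rightarrow> (nat \<Rightarrow> nat \<Rightarrow> int)
    \<Rightarrow> int list" where
  "a_word k t p a x =
     X_word p x 0 @ concat (map (\<lambda>i. A_word t a i @ X_word p x i) [1..<k + 1])"

definition T_word :: "nat \<Rightarrow> nat \<Rightarrow> (nat \<Rightarrow> nat) \<Rightarrow> (nat \<Rightarrow> nat) \<Rightarrow> (nat \<Rightarrow> int) \<Rightarrow> (nat \<Rightarrow> nat \<Rightarrow> int)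
    \<Rightarrow> nat \<Rightarrow> nat \<Rightarrow> int list" where
  "T_word l k t p a x i j =
     (let y = xpos t a x i j; z = (if j = 0 \<or> even y then y else y + 1) in
      [z + 1 .. z + len l k t p a x i j])"

definition T_row :: "nat \<Rightarrow> nat \<Rightarrow> (nat \<Rightarrow> nat) \<Rightarrow> (nat \<Rightarrow> nat) \<Rightarrow> (nat \<Rightarrow> int) \<Rightarrow> (nat \<Rightarrow> nat \<Rightarrow> int)
    \<Rightarrow> nat \<Rightarrow> int list" where
  "T_row l k t p a x i =
     T_word l k t p a x i 0 @ concat (map (\<lambda>j. x i j # T_word l k t p a x i j) [1..<p i + 1])"

definition T_col :: "nat \<Rightarrow> nat \<Rightarrow> (nat \<Rightarrow> nat) \<Rightarrow> (nat \<Rightarrow> nat) \<Rightarrow> (nat \<Rightarrow> int) \<Rightarrow> (nat \<Rightarrow> nat \<Rightarrow> int)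
    \<Rightarrow> int list" where
  "T_col l k t p a x =
     T_row l k t p a x 0 @ concat (map (\<lambda>i. A_word t a i @ T_row l k t p a x i) [1..<k + 1])"

end

theory Submission
  imports Defs
begin

text \<open>
  Split \<open>{1..2n}\<close> into dominoes \<open>{2m+1, 2m+2}\<close>. Read an empty domino as an opening bracket and
  a full one as a closing bracket, ignoring dominoes with one entry. Counting entries turns the
  defining inequality of \<open>rem\<close> into the statement that a full domino is removed iff it is an
  unmatched closing bracket. A column is recovered from its reduction by filling the
  first \<open>(l - t) / 2\<close> unmatched empty dominoes, and the numbers \<open>l_m\<close> count the entries that this
  greedy filling puts between consecutive entries of \<open>a\<close>.
\<close>

section \<open>Reduction as bracket matching\<close>

text \<open>
  \<open>fill m u v\<close>: the column \<open>v\<close> lies in the first \<open>m\<close> dominoes and reduces to \<open>u\<close>. The number of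
  currently open brackets is \<open>m - (length u + length v) / 2\<close>.
\<close>

inductive fill :: "int \<Rightarrow> int list \<Rightarrow> int list \<Rightarrow> bool" where
  Nil: "fill 0 [] []"
| skip: "fill m u v \<Longrightarrow> fill (m + 1) u v"
| single: "fill m u v \<Longrightarrow> y = 2 * m + 1 \<or> y = 2 * m + 2 \<Longrightarrow> fill (m + 1) (u @ [y]) (v @ [y])"
| keep: "fill m u v \<Longrightarrow> int (length u) + int (length v) < 2 * m \<Longrightarrow>
    fill (m + 1) (u @ [2 * m + 1, 2 * m + 2]) (v @ [2 * m + 1, 2 * m + 2])"
| remove: "fill m u v \<Longrightarrow> int (length u) + int (length v) = 2 * m \<Longrightarrow>
    fill (m + 1) u (v @ [2 * m + 1, 2 * m + 2])"

lemma fill_invariants: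
  assumes "fill m u v"
  shows "0 \<le> m" "int (length u) + int (length v) \<le> 2 * m" "length u \<le> length v"
    "even (length u + length v)" "sorted_wrt (<) v" "set v \<subseteq> {1..2 * m}" "set u \<subseteq> set v"
proof -
  have "0 \<le> m \<and> int (length u) + int (length v) \<le> 2 * m \<and> length u \<le> length v \<and>
    even (length u + length v) \<and> sorted_wrt (<) v \<and> set v \<subseteq> {1..2 * m} \<and> set u \<subseteq> set v"
    using assms
  proof induction
    case (keep m u v)
    \<comment> \<open>By parity, one spare unit in the strict inequality is in fact two: a whole
      bracket is open, which is what \<open>keep\<close> consumes.\<close>
    then obtain c where c: "length u + length v = 2 * c" unfolding dvd_def by blast
    then have "int (length u) + int (length v) = 2 * int c" by presburger
    moreover from this keep(2) have "int c + 1 \<le> m" by linarith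
    ultimately have "int (length u) + int (length v) + 2 \<le> 2 * m" by linarith
    with keep show ?case by (fastforce simp: sorted_wrt_append)
  qed (fastforce simp: sorted_wrt_append)+
  then show "0 \<le> m" "int (length u) + int (length v) \<le> 2 * m" "length u \<le> length v"
    "even (length u + length v)" "sorted_wrt (<) v" "set v \<subseteq> {1..2 * m}" "set u \<subseteq> set v"
    by blast+
qed

section \<open>The removal set along a column\<close>

lemma rem_set_subset: "rem_set b \<subseteq> set b"
proof (induction b rule: rem_set.induct)
  case (1 b)
  show ?case
  proof (cases "length b \<le> 1")
    case True
    then show ?thesis by (simp add: rem_set.simps)
  next
    case False
    then have "b \<noteq> []"
      by auto
    with False have "{b ! (length b - 2), last b} \<subseteq> set b"
      by simp
    moreover have "set (butlast b) \<subseteq> set b" "set (take (length b - 2) b) \<subseteq> set b"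
      by (auto dest: in_set_butlastD in_set_takeD)
    ultimately show ?thesis
      using 1 False by (subst rem_set.simps) (simp only: if_False split: if_split, blast)
  qed
qed

lemma rem_set_snoc:
  assumes "\<not> (even y \<and> y - 1 \<in> set v)"
  shows "rem_set (v @ [y]) = rem_set v"
proof (cases "v = []")
  case True
  then show ?thesis by (simp add: rem_set.simps)
next
  case False
  then have "(v @ [y]) ! (length (v @ [y]) - 2) \<in> set v"
    by (auto simp: nth_append)
  with assms False show ?thesis
    by (subst rem_set.simps) auto
qed

text \<open>The test in \<open>rem_set\<close> concerns a column of length
  \<open>length v + 2\<close>, which accounts for the constant 3. If it fails, the odd entry
  \<open>z\<close> is dropped as well.\<close>

lemma rem_set_snoc2:
  assumes "even y" "y - 1 \<notin> set v" "odd z" "z = y - 1"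
  shows "rem_set (v @ [z, y]) =
    (if y < 2 * int (length v) + 3 - int (card (rem_set v))
     then rem_set v \<union> {z, y} else rem_set v)"
proof -
  have "rem_set (butlast (v @ [z, y])) = rem_set v"
    using assms by (simp add: butlast_append rem_set_snoc)
  then show ?thesis
    using assms by (subst rem_set.simps) (auto simp: nth_append)
qed

text \<open>The cardinality is carried along because it turns the test
  \<open>2 * m + 2 < 2 * length v + 3 - card\<close> at a full domino into
  \<open>2 * m \<le> length u + length v\<close>. The reverse inequality is an invariant of
  \<open>fill\<close>, so the test succeeds exactly when no bracket is open.\<close>

lemma fill_rem_set:
  assumes "fill m u v"
  shows "red v = u \<and> int (card (rem_set v)) = int (length v) - int (length u)"
  using assms
proof induction
  case Nil
  then show ?case by (simp add: red_def rem_set.simps)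
next
  case (skip m u v)
  then show ?case by simp
next
  case (single m u v y)
  note inv = fill_invariants[OF single(1)]
  have "y - 1 \<notin> set v \<or> odd y" "y \<notin> rem_set v"
    using single(2) inv(6) rem_set_subset[of v] by auto
  then show ?case
    using single(3) by (auto simp: red_def rem_set_snoc)
next
  case (keep m u v)
  note inv = fill_invariants[OF keep(1)]
  have notin: "2 * m + 2 - 1 \<notin> set v" "2 * m + 1 \<notin> rem_set v" "2 * m + 2 \<notin> rem_set v"
    using inv(6) rem_set_subset[of v] by auto
  have "rem_set (v @ [2 * m + 1, 2 * m + 2]) = rem_set v"
    using keep(2,3) by (subst rem_set_snoc2[OF _ notin(1)]) auto
  then show ?case
    using keep(3) notin by (auto simp: red_def)
next
  case (remove m u v)
  note inv = fill_invariants[OF remove(1)]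
  have notin: "2 * m + 2 - 1 \<notin> set v" "2 * m + 1 \<notin> set v" "2 * m + 2 \<notin> set v"
    using inv(6) by auto
  have rem: "rem_set (v @ [2 * m + 1, 2 * m + 2]) = rem_set v \<union> {2 * m + 1, 2 * m + 2}"
    using remove(2,3) by (subst rem_set_snoc2[OF _ notin(1)]) auto
  have "filter (\<lambda>y. y \<notin> rem_set v \<union> {2 * m + 1, 2 * m + 2}) v = red v"
    unfolding red_def using notin by (intro filter_cong) auto
  moreover have "finite (rem_set v)" "2 * m + 1 \<notin> rem_set v" "2 * m + 2 \<notin> rem_set v"
    using notin rem_set_subset[of v] finite_subset by auto
  ultimately show ?case
    using remove(3) unfolding rem red_def[of "v @ _"] by simp
qed

section \<open>Every column arises from \<open>fill\<close>, and its reduction and length determine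
  it\<close>

lemma fill_exists:
  assumes "sorted_wrt (<) v" "set v \<subseteq> {1..2 * int n}"
  shows "\<exists>u. fill (int n) u v"
  using assms
proof (induction n arbitrary: v)
  case 0
  then show ?case using fill.Nil by auto
next
  case (Suc n)
  define v1 where "v1 = filter (\<lambda>y. y \<le> 2 * int n) v"
  define v2 where "v2 = filter (\<lambda>y. \<not> y \<le> 2 * int n) v"
  have sorted: "sorted_wrt (<) v1" "sorted_wrt (<) v2"
    using Suc.prems unfolding v1_def v2_def by (auto simp: sorted_wrt_filter)
  have sub: "set v1 \<subseteq> {1..2 * int n}" "set v2 \<subseteq> {2 * int n + 1, 2 * int n + 2}"
    using Suc.prems unfolding v1_def v2_def by fastforce+
  have "v = v1 @ v2"
  proof (rule sorted_distinct_set_unique)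
    show "sorted v" "distinct v"
      using Suc.prems strict_sorted_iff by auto
    have "sorted_wrt (<) (v1 @ v2)"
      using sorted sub by (fastforce simp: sorted_wrt_append)
    then show "sorted (v1 @ v2)" "distinct (v1 @ v2)"
      using strict_sorted_iff by blast+
    show "set v = set (v1 @ v2)"
      unfolding v1_def v2_def by auto
  qed
  obtain u where u: "fill (int n) u v1"
    using Suc.IH sorted(1) sub(1) by blast
  \<comment> \<open>An empty top domino calls for \<open>skip\<close>, one entry for
    \<open>single\<close>, and a full domino for \<open>keep\<close> or \<open>remove\<close>
    according to whether a bracket is open.\<close>
  have "v2 = [] \<or> v2 = [2 * int n + 1] \<or> v2 = [2 * int n + 2] \<or>
      v2 = [2 * int n + 1, 2 * int n + 2]"
  proof (cases v2)
    case (Cons y ys)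
    then show ?thesis
    proof (cases ys)
      case (Cons z zs)
      then show ?thesis
        using sorted(2) sub(2) \<open>v2 = y # ys\<close> by (cases zs) auto
    qed (use sub(2) in auto)
  qed auto
  moreover have "int (length u) + int (length v1) < 2 * int n \<or>
      int (length u) + int (length v1) = 2 * int n"
    using fill_invariants(2)[OF u] by linarith
  ultimately show ?case
    unfolding \<open>v = v1 @ v2\<close>
    using fill.skip[OF u] fill.single[OF u] fill.keep[OF u] fill.remove[OF u]
    by (auto simp: add.commute)
qed

lemma fill_red:
  assumes "sorted_wrt (<) v" "set v \<subseteq> {1..2 * int n}"
  shows "fill (int n) (red v) v"
  using fill_exists[OF assms] fill_rem_set by blast

text \<open>
  The only ambiguous case is an empty top domino of \<open>u\<close>. After \<open>skip\<close> at least one bracket is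
  open, after \<open>remove\<close> none is, and the lengths tell these apart.
\<close>

lemma fill_unique:
  assumes "fill m u v" "fill m u v'" "length v = length v'"
  shows "v = v'"
  using assms
proof (induction arbitrary: v')
  case Nil
  then show ?case by simp
next
  case (skip m u v)
  note inv = fill_invariants[OF skip(1)]
  from skip(3) show ?case
  proof cases
    case (skip m')
    then show ?thesis using skip.IH skip.prems by simp
  qed (use inv skip(4) in auto)
next
  case (single m u v y)
  note inv = fill_invariants[OF single(1)]
  from single(4) show ?case
  proof cases
    case Nil
    then show ?thesis using inv(1) by simp
  next
    case skip
    with fill_invariants(6,7)[OF skip(2)] single(2) show ?thesis by auto
  next
    case (single m' u' v'' y')
    then show ?thesis using single.IH single.prems by simp
  next
    case (keep m' u' v'')
    \<comment> \<open>\<open>u\<close> would end in \<open>2 * m + 1\<close>, although its entries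
      are at most \<open>2 * m\<close>.\<close>
    then have "u = u' @ [2 * m + 1]" "m' = m"
      by (auto simp flip: append_assoc[of _ "[_]" "[_]", simplified])
    then show ?thesis using inv(6,7) by auto
  next
    case (remove m' v'')
    with fill_invariants(6,7)[OF remove(3)] single(2) show ?thesis by auto
  qed
next
  case (keep m u v)
  note inv = fill_invariants[OF keep(1)]
  from keep(4) show ?case
  proof cases
    case Nil
    then show ?thesis using inv(1) by simp
  next
    case skip
    with fill_invariants(6,7)[OF skip(2)] show ?thesis by auto
  next
    case (single m' u' v'' y')
    then have "u' = u @ [2 * m + 1]" "m' = m"
      by (auto simp flip: append_assoc[of _ "[_]" "[_]", simplified])
    then show ?thesis using fill_invariants(6,7)[OF single(4)] by auto
  next
    case (keep m' u' v'')
    then show ?thesis using keep.IH keep.prems by simp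
  next
    case (remove m' v'')
    with fill_invariants(6,7)[OF remove(3)] show ?thesis by auto
  qed
next
  case (remove m u v)
  note inv = fill_invariants[OF remove(1)]
  from remove(4) show ?case
  proof cases
    case skip
    with fill_invariants(2)[OF skip(2)] remove(2,5) show ?thesis by auto
  next
    case (remove m' v'')
    then show ?thesis using remove.IH remove.prems by simp
  qed (use inv in auto)
qed

section \<open>Runs of equal steps\<close>

lemma fill_skips:
  assumes "fill m u v" "m \<le> m'"
  shows "fill m' u v"
  using assms(2,1) by (induction rule: int_ge_induct) (auto intro: fill.skip)

lemma upto_snoc2:
  assumes "m \<le> (m' :: int)"
  shows "[2 * m + 1..2 * (m' + 1)] = [2 * m + 1..2 * m'] @ [2 * m' + 1, 2 * m' + 2]"
  using assms upto_split1[of "2 * m + 1" "2 * m' + 1" "2 * m' + 2"]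
  by (simp add: upto.simps upto_rec2)

text \<open>Removing a full domino leaves the number of open brackets at zero, so the step can be
  repeated.\<close>

lemma fill_removes:
  assumes "fill m u v" "m \<le> m'" "int (length u) + int (length v) = 2 * m"
  shows "fill m' u (v @ [2 * m + 1..2 * m'])"
  using assms(2,1,3)
proof (induction rule: int_ge_induct)
  case (step m')
  then have "fill (m' + 1) u ((v @ [2 * m + 1..2 * m']) @ [2 * m' + 1, 2 * m' + 2])"
    by (intro fill.remove) auto
  then show ?case
    unfolding upto_snoc2[OF step.hyps(1)] by (simp only: append_assoc)
qed auto

text \<open>Each kept domino closes one bracket; the length hypothesis says that at least
  \<open>m' - m\<close> brackets are open at the start.\<close>

lemma fill_keeps:
  assumes "fill m u v" "m \<le> m'" "int (length u) + int (length v) + 2 * (m' - m) \<le> 2 * m"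
  shows "fill m' (u @ [2 * m + 1..2 * m']) (v @ [2 * m + 1..2 * m'])"
  using assms(2,1,3)
proof (induction rule: int_ge_induct)
  case (step m')
  then have "fill (m' + 1) ((u @ [2 * m + 1..2 * m']) @ [2 * m' + 1, 2 * m' + 2])
      ((v @ [2 * m + 1..2 * m']) @ [2 * m' + 1, 2 * m' + 2])"
    by (intro fill.keep) auto
  then show ?case
    unfolding upto_snoc2[OF step.hyps(1)] by (simp only: append_assoc)
qed auto

section \<open>The greedy filling\<close>

text \<open>Regroups a row so that each inserted word is followed by the next entry of
  \<open>a\<close>, the order in which the induction along a row proceeds.\<close>

lemma concat_map_shift:
  "f 0 @ concat (map (\<lambda>j. g j # f j) [1..<n + 1]) =
    concat (map (\<lambda>j. f j @ [g (Suc j)]) [0..<n]) @ f n"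
  by (induction n) auto

lemma a_word_0: "a_word 0 t p a x = X_word p x 0"
  by (simp add: a_word_def)

lemma a_word_Suc:
  "a_word (Suc i) t p a x = a_word i t p a x @ A_word t a (Suc i) @ X_word p x (Suc i)"
  by (simp add: a_word_def)

lemma a_word_prefix: "i \<le> k \<Longrightarrow> \<exists>ys. a_word k t p a x = a_word i t p a x @ ys"
  by (induction rule: dec_induct) (auto simp: a_word_Suc)

lemma length_X_word [simp]: "length (X_word p x i) = p i"
  by (simp add: X_word_def)

lemma set_X_word: "set (X_word p x i) = x i ` {1..p i}"
  by (auto simp: X_word_def simp del: upt_Suc)

lemma xpos_Suc: "xpos t a x i (Suc j) = x i (Suc j)"
  by (simp add: xpos_def)

lemma length_A_word [simp]: "length (A_word t a i) = t i"
  by (simp add: A_word_def)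

lemma tsum_Suc: "tsum t p (Suc i) = tsum t p i + t (Suc i) + p (Suc i)"
  by (simp add: tsum_def)

lemma length_a_word: "length (a_word i t p a x) = tsum t p i"
  by (induction i) (simp_all add: a_word_0 a_word_Suc tsum_Suc, simp add: tsum_def)

text \<open>The last length of a row is the remainder. Hence \<open>S_i\<close> is simply the sum of
  the earlier values of \<open>ltil\<close>.\<close>

lemma row_len_sum: "(\<Sum>j\<le>p i. row_len t p a x i L j) = L"
proof -
  have "row_len t p a x i L (p i) = L - (\<Sum>j<p i. row_len t p a x i L j)"
    by (subst row_len.simps) simp
  then show ?thesis
    by (simp flip: lessThan_Suc_atMost)
qed

lemma xpos_in_a_word:
  assumes "j \<le> p i" "i = 0 \<Longrightarrow> 0 < j" "0 < i \<Longrightarrow> 0 < t i"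
  shows "xpos t a x i j \<in> set (a_word i t p a x)"
proof (cases "j = 0")
  case True
  with assms obtain i' where "i = Suc i'" by (cases i) auto
  with True assms show ?thesis by (auto simp: a_word_Suc A_word_def xpos_def)
next
  case False
  then have "xpos t a x i j \<in> set (X_word p x i)"
    using assms(1) by (auto simp: set_X_word xpos_def)
  then show ?thesis by (cases i) (auto simp: a_word_0 a_word_Suc)
qed

section \<open>The data of the theorem and the bracket counts attached to them\<close>

locale column_data =
  fixes l k n :: nat and t p :: "nat \<Rightarrow> nat" and a :: "nat \<Rightarrow> int" and x :: "nat \<Rightarrow> nat \<Rightarrow> int"
  assumes t_pos: "0 < i \<Longrightarrow> i \<le> k \<Longrightarrow> 0 < t i"
    and t_even: "0 < i \<Longrightarrow> i \<le> k \<Longrightarrow> even (t i)"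
    and a_odd: "0 < i \<Longrightarrow> i \<le> k \<Longrightarrow> odd (a i)"
    and a_ge: "0 < i \<Longrightarrow> i \<le> k \<Longrightarrow> a i \<ge> 2 * int (tsum t p (i - 1)) + int (t i) + 1"
    and sorted: "sorted_wrt (<) (a_word k t p a x)"
    and range: "set (a_word k t p a x) \<subseteq> {1..2 * int n}"
    and unpaired: "i \<le> k \<Longrightarrow> 0 < j \<Longrightarrow> j \<le> p i \<Longrightarrow>
      parity_inv (x i j) \<notin> set (a_word k t p a x)"
    and tsum_le: "tsum t p k \<le> l" "tsum t p k + l \<le> 2 * n"
    and even_diff: "even (l - tsum t p k)"
begin

abbreviation "pos \<equiv> xpos t a x"
abbreviation "ln i j \<equiv> len l k t p a x i j"

text \<open>The number of dominoes up to and including the one that contains \<open>pos i j\<close>;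
  it is 0 for the convention value 0.\<close>

definition half :: "nat \<Rightarrow> nat \<Rightarrow> int" where
  "half i j = (pos i j + 1) div 2"

text \<open>
  Twice the number of open brackets right after \<open>A_j\<close> in \<open>a\<close>. The minimum of these over
  all \<open>j > i\<close> is twice the number of unmatched opening brackets before \<open>A_(i+1)\<close>.
\<close>

definition slack :: "nat \<Rightarrow> int" where
  "slack j = a j - 2 * int (tsum t p (j - 1)) - int (t j) - 1"

definition bound :: "nat \<Rightarrow> int" where
  "bound i = Min (insert (int l - int (tsum t p k)) (slack ` {i + 1..k}))"

text \<open>The number of entries inserted before row \<open>i\<close>. Row 0 needs its own case,
  since truncated subtraction would give \<open>bound 0\<close>.\<close>

definition prev :: "nat \<Rightarrow> int" where
  "prev i = (if i = 0 then 0 else bound (i - 1))"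

definition rest :: "nat \<Rightarrow> nat \<Rightarrow> int" where
  "rest i j = ltil l k t p a x i - (\<Sum>m<j. ln i m)"

text \<open>\<open>T_col\<close> cut off after row \<open>i\<close>. The lengths keep the parameter
  \<open>k\<close>, because a smaller \<open>k\<close> would change the minima in
  \<open>ltil\<close>.\<close>

definition col :: "nat \<Rightarrow> int list" where
  "col i = T_row l k t p a x 0 @ concat (map (\<lambda>i. A_word t a i @ T_row l k t p a x i) [1..<i + 1])"

text \<open>All members of the minimum defining \<open>ltil\<close> are shifted by the same
  \<open>S_i\<close>, so adding the earlier values back leaves an unshifted minimum. Thus
  \<open>bound i\<close> is the number of entries inserted in rows 0 to \<open>i\<close>.\<close>

lemma ltil_sum: "(\<Sum>r<Suc i. ltil l k t p a x r) = bound i"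
proof -
  define S where "S = (\<Sum>r<i. ltil l k t p a x r)"
  let ?M = "insert (int l - int (tsum t p k)) (slack ` {i + 1..k})"
  have "ltil l k t p a x i = Min ((\<lambda>y. y - S) ` ?M)"
    unfolding S_def
    by (subst ltil.simps) (simp add: row_len_sum Let_def image_image slack_def algebra_simps)
  also have "\<dots> = bound i - S"
    unfolding bound_def by (rule mono_Min_commute[symmetric]) (auto simp: mono_def)
  finally show ?thesis
    by (simp add: S_def)
qed

lemma ltil_eq: "ltil l k t p a x i = bound i - prev i"
  using ltil_sum[of i] ltil_sum[of "i - 1"] by (cases i) (auto simp: prev_def)

lemma slack_even_nonneg: "0 < i \<Longrightarrow> i \<le> k \<Longrightarrow> 0 \<le> slack i \<and> even (slack i)"
  using a_ge[of i] a_odd[of i] t_even[of i] by (auto simp: slack_def)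

lemma bound_even_nonneg: "0 \<le> bound i \<and> even (bound i)"
proof -
  have "bound i \<in> insert (int l - int (tsum t p k)) (slack ` {i + 1..k})"
    unfolding bound_def by (rule Min_in) auto
  moreover have "even (int l - int (tsum t p k))"
    using even_diff tsum_le(1) by (metis even_of_nat of_nat_diff)
  ultimately show ?thesis
    using slack_even_nonneg tsum_le(1) by auto
qed

lemma bound_last: "bound k = int l - int (tsum t p k)"
  by (simp add: bound_def)

lemma bound_min:
  assumes "i < k"
  shows "bound i = min (slack (Suc i)) (bound (Suc i))"
proof -
  have "{i + 1..k} = insert (Suc i) {Suc i + 1..k}"
    using assms by auto
  then show ?thesis
    unfolding bound_def by (simp add: insert_commute)
qed

text \<open>For \<open>0 < i\<close>, \<open>prev i\<close> is the minimum of \<open>slack i\<close>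
  and \<open>bound i\<close>. Either the earlier insertions leave no bracket open after
  \<open>A_i\<close>, or row \<open>i\<close> has nothing to insert.\<close>

lemma prev_cases:
  assumes "i \<le> k"
  shows "0 \<le> prev i" "even (prev i)" "prev i \<le> bound i"
    "0 < i \<Longrightarrow> prev i = slack i \<or> prev i = bound i"
  using bound_even_nonneg[of i] bound_even_nonneg[of "i - 1"] bound_min[of "i - 1"] assms
  by (auto simp: prev_def)

section \<open>The dominoes of the entries of \<open>a\<close>\<close>

lemma sorted_a_word:
  assumes "i \<le> k"
  shows "sorted_wrt (<) (a_word i t p a x)" "set (a_word i t p a x) \<subseteq> set (a_word k t p a x)"
  using a_word_prefix[OF assms, of t p a x] sorted by (auto simp: sorted_wrt_append)

lemma even_pos_0: "i \<le> k \<Longrightarrow> even (pos i 0)"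
  using a_odd[of i] t_even[of i] by (auto simp: xpos_def)

lemma half_0: "i \<le> k \<Longrightarrow> 2 * half i 0 = pos i 0"
  using even_pos_0[of i] by (auto simp: half_def elim!: evenE)

lemma pos_less_Suc:
  assumes "i \<le> k" "j < p i"
  shows "pos i j < x i (Suc j)"
proof (cases "j = 0")
  case True
  have "x i 1 \<in> set (X_word p x i)"
    using assms by (auto simp: set_X_word)
  show ?thesis
  proof (cases i)
    case 0
    have "x i 1 \<in> set (a_word k t p a x)"
      using sorted_a_word(2)[of 0] \<open>x i 1 \<in> _\<close> 0 by (auto simp: a_word_0)
    then show ?thesis using True 0 range by (auto simp: xpos_def)
  next
    case (Suc i')
    have "pos i 0 \<in> set (A_word t a i)"
      using Suc assms t_pos[of i] by (auto simp: A_word_def xpos_def)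
    then show ?thesis
      using sorted_a_word(1)[OF assms(1)] \<open>x i 1 \<in> _\<close> Suc True
      by (auto simp: a_word_Suc sorted_wrt_append)
  qed
next
  case False
  have "sorted_wrt (<) (X_word p x i)"
    using sorted_a_word(1)[OF assms(1)] by (cases i) (auto simp: a_word_0 a_word_Suc sorted_wrt_append)
  then have "X_word p x i ! (j - 1) < X_word p x i ! j"
    by (rule sorted_wrt_nth_less) (use assms False in auto)
  then show ?thesis
    using assms False by (auto simp: X_word_def xpos_def simp del: upt_Suc)
qed

text \<open>Successive positions lie in different dominoes: an even position ends its domino, and
  the partner of an odd one is not in \<open>a\<close>.\<close>

lemma half_less_Suc:
  assumes "i \<le> k" "j < p i"
  shows "half i j + 1 \<le> half i (Suc j)"
proof (cases "even (pos i j)")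
  case True
  then show ?thesis
    using pos_less_Suc[OF assms] by (auto simp: half_def xpos_def)
next
  case False
  then have "0 < j" using even_pos_0[OF assms(1)] by (cases j) auto
  then have "pos i j = x i j" by (simp add: xpos_def)
  moreover have "x i (Suc j) \<in> set (a_word k t p a x)"
    using xpos_in_a_word[of "Suc j" p i t a x] assms t_pos[of i] sorted_a_word(2)[of i]
    by (auto simp: xpos_def)
  ultimately have "x i (Suc j) \<noteq> pos i j + 1"
    using unpaired[of i j] \<open>0 < j\<close> assms False by (auto simp: parity_inv_def)
  then have "pos i j + 2 \<le> x i (Suc j)"
    using pos_less_Suc[OF assms] by linarith
  with False show ?thesis
    unfolding half_def xpos_Suc by presburger
qed

text \<open>The parity cases of \<open>gap\<close> all count the places in the dominoes strictly
  between those of the two positions.\<close>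

lemma gap_eq:
  assumes "i \<le> k"
  shows "gap t a x i j = 2 * (half i (Suc j) - half i j - 1)"
proof (cases "j = 0")
  case True
  then show ?thesis
    using even_pos_0[OF assms]
    by (cases "even (pos i 1)") (auto simp: gap_def half_def Let_def elim!: evenE oddE)
next
  case False
  then show ?thesis
    by (cases "even (pos i j)"; cases "even (pos i (Suc j))")
      (auto simp: gap_def half_def Let_def elim!: evenE oddE)
qed

lemma half_last:
  assumes "i < k"
  shows "2 * half i (p i) \<le> a (Suc i) - 1"
proof -
  have "a (Suc i) \<in> set (A_word t a (Suc i))"
    using t_pos[of "Suc i"] assms by (auto simp: A_word_def)
  then have mem: "a (Suc i) \<in> set (a_word (Suc i) t p a x)"
    by (simp add: a_word_Suc)
  have "pos i (p i) < a (Suc i)"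
  proof (cases "i = 0 \<and> p i = 0")
    case True
    then show ?thesis using mem sorted_a_word(2)[of "Suc i"] range assms by (auto simp: xpos_def)
  next
    case False
    then have "pos i (p i) \<in> set (a_word i t p a x)"
      using t_pos[of i] assms by (intro xpos_in_a_word) auto
    then show ?thesis
      using sorted_a_word(1)[of "Suc i"] assms \<open>a (Suc i) \<in> set (A_word t a (Suc i))\<close>
      by (auto simp: a_word_Suc sorted_wrt_append)
  qed
  then show ?thesis
    using a_odd[of "Suc i"] assms by (auto simp: half_def elim!: oddE)
qed

lemma half_end: "2 * half k (p k) \<le> 2 * int n"
proof (cases "k = 0 \<and> p k = 0")
  case True
  then have "pos k (p k) = 0" by (metis xpos_def)
  then show ?thesis by (simp add: half_def)
next
  case False
  then have "pos k (p k) \<in> set (a_word k t p a x)"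
    using t_pos[of k] by (intro xpos_in_a_word) auto
  then have "pos k (p k) \<le> 2 * int n"
    using range by auto
  then show ?thesis
    unfolding half_def by presburger
qed

section \<open>The recursion for the inserted lengths\<close>

lemma rest_0: "rest i 0 = bound i - prev i"
  by (simp add: rest_def ltil_eq)

lemma rest_Suc: "rest i (Suc j) = rest i j - ln i j"
  by (simp add: rest_def)

lemma ln_eq: "ln i j = (if j < p i then min (gap t a x i j) (rest i j) else rest i j)"
  unfolding len_def rest_def by (subst row_len.simps) (simp add: Let_def)

lemma rest_even_nonneg:
  assumes "i \<le> k" "j \<le> p i"
  shows "0 \<le> rest i j \<and> even (rest i j)"
  using assms(2)
proof (induction j)
  case 0
  then show ?case
    using prev_cases[OF assms(1)] bound_even_nonneg[of i] by (simp add: rest_0)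
next
  case (Suc j)
  then show ?case
    using gap_eq[OF assms(1), of j] by (auto simp: rest_Suc ln_eq min_def)
qed

lemma ln_even_nonneg:
  assumes "i \<le> k" "j \<le> p i"
  shows "0 \<le> ln i j" "even (ln i j)"
  using rest_even_nonneg[OF assms] half_less_Suc[OF assms(1), of j]
  by (auto simp: ln_eq gap_eq[OF assms(1)] min_def)

text \<open>The extra shift after an odd entry moves the start of the word to a domino
  boundary.\<close>

lemma T_word_eq:
  assumes "i \<le> k"
  shows "T_word l k t p a x i j = [2 * half i j + 1..2 * half i j + ln i j]"
proof (cases "even (pos i j)")
  case True
  then show ?thesis
    by (auto simp: T_word_def half_def Let_def elim!: evenE)
next
  case False
  then have "j \<noteq> 0"
    using even_pos_0[OF assms] by metis
  with False show ?thesis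
    by (auto simp: T_word_def half_def Let_def algebra_simps elim!: oddE)
qed

text \<open>Either nothing is left to insert and the word is empty, or no bracket is open and every
  inserted domino is removed.\<close>

lemma fill_T_word:
  assumes "i \<le> k" "j \<le> p i" "fill (half i j) u v"
    and "rest i j = 0 \<or> int (length u) + int (length v) = 2 * half i j"
  shows "fill (half i j + ln i j div 2) u (v @ T_word l k t p a x i j)"
    "int (length (T_word l k t p a x i j)) = ln i j"
proof -
  obtain e where e: "ln i j = 2 * e" "0 \<le> e"
    using ln_even_nonneg[OF assms(1,2)] by (auto elim: evenE)
  have word: "T_word l k t p a x i j = [2 * half i j + 1..2 * (half i j + e)]"
    using T_word_eq[OF assms(1)] e by (simp add: algebra_simps)
  show "int (length (T_word l k t p a x i j)) = ln i j"
    using e by (simp add: word)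
  show "fill (half i j + ln i j div 2) u (v @ T_word l k t p a x i j)"
  proof (cases "e = 0")
    case True
    then show ?thesis using assms(3) e word by simp
  next
    case False
    \<comment> \<open>\<open>ln i j\<close> never exceeds \<open>rest i j\<close>.\<close>
    then have "rest i j \<noteq> 0"
      using e rest_even_nonneg[OF assms(1,2)] half_less_Suc[OF assms(1), of j]
      by (auto simp: ln_eq min_def split: if_splits)
    then show ?thesis
      using fill_removes[OF assms(3), of "half i j + e"] assms(4) e word by simp
  qed
qed

text \<open>The invariant survives because \<open>ln i j\<close> is a minimum: if it equals the gap,
  every empty domino before the next entry is filled and no bracket opens; if it equals
  \<open>rest i j\<close>, nothing remains to insert.\<close>

lemma fill_row_prefix:
  assumes "i \<le> k" "fill (half i 0) u v"
    and "rest i 0 = 0 \<or> int (length u) + int (length v) = 2 * half i 0"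
    and "j \<le> p i"
  defines "uj \<equiv> \<lambda>j. u @ map (x i) [1..<j + 1]"
    and "vj \<equiv> \<lambda>j. v @ concat (map (\<lambda>j. T_word l k t p a x i j @ [x i (Suc j)]) [0..<j])"
  shows "fill (half i j) (uj j) (vj j) \<and>
    int (length (vj j)) = int (length v) + int j + rest i 0 - rest i j \<and>
    (rest i j = 0 \<or> int (length (uj j)) + int (length (vj j)) = 2 * half i j)"
  using assms(4)
proof (induction j)
  case 0
  then show ?case using assms by simp
next
  case (Suc j)
  let ?T = "T_word l k t p a x i j" and ?m = "half i (Suc j) - 1"
  have j: "j < p i" using Suc by simp
  have IH: "fill (half i j) (uj j) (vj j)"
    "int (length (vj j)) = int (length v) + int j + rest i 0 - rest i j"
    "rest i j = 0 \<or> int (length (uj j)) + int (length (vj j)) = 2 * half i j"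
    using Suc by auto
  have T: "fill (half i j + ln i j div 2) (uj j) (vj j @ ?T)" "int (length ?T) = ln i j"
    using fill_T_word[OF assms(1) _ IH(1,3)] j by auto
  have ln: "ln i j = min (2 * (?m - half i j)) (rest i j)"
    using j by (simp add: ln_eq gap_eq[OF assms(1)])
  then have "ln i j \<le> 2 * (?m - half i j)" by simp
  then have "half i j + ln i j div 2 \<le> ?m" by presburger
  \<comment> \<open>The dominoes that the word does not reach are skipped, up to the one containing
    \<open>x i (Suc j)\<close>.\<close>
  then have "fill ?m (uj j) (vj j @ ?T)"
    by (rule fill_skips[OF T(1)])
  moreover have "x i (Suc j) = 2 * ?m + 1 \<or> x i (Suc j) = 2 * ?m + 2"
    by (simp add: half_def xpos_def) presburger
  ultimately have "fill (?m + 1) (uj j @ [x i (Suc j)]) ((vj j @ ?T) @ [x i (Suc j)])"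
    by (rule fill.single)
  moreover have [simp]: "uj (Suc j) = uj j @ [x i (Suc j)]" "vj (Suc j) = vj j @ ?T @ [x i (Suc j)]"
    by (simp_all add: uj_def vj_def)
  ultimately show ?case
    using IH(2,3) T(2) ln by (auto simp: rest_Suc min_def)
qed

lemma fill_row:
  assumes "i \<le> k" "fill (half i 0) u v"
    and "length u + p i = tsum t p i" "int (length v) = int (length u) + prev i"
  shows "\<exists>m. fill m (u @ X_word p x i) (v @ T_row l k t p a x i) \<and>
    2 * m \<le> (if i < k then a (Suc i) - 1 else 2 * int n) \<and>
    int (length (v @ T_row l k t p a x i)) = int (tsum t p i) + bound i"
proof -
  let ?vp = "v @ concat (map (\<lambda>j. T_word l k t p a x i j @ [x i (Suc j)]) [0..<p i])"
  let ?T = "T_word l k t p a x i (p i)"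
  \<comment> \<open>For \<open>0 < i\<close>, twice the number of brackets open here is
    \<open>slack i - prev i\<close>. Row 0 starts from two empty words.\<close>
  have "rest i 0 = 0 \<or> int (length u) + int (length v) = 2 * half i 0"
  proof (cases i)
    case 0
    then show ?thesis using assms(3,4) by (simp add: prev_def half_def xpos_def tsum_def)
  next
    case (Suc i')
    then show ?thesis
      using assms(3,4) prev_cases(4)[OF assms(1)] half_0[OF assms(1)]
      by (auto simp: rest_0 slack_def tsum_Suc xpos_def)
  qed
  note prefix = fill_row_prefix[OF assms(1,2) this order_refl]
  have vp: "fill (half i (p i)) (u @ X_word p x i) ?vp"
    "int (length ?vp) = int (length v) + int (p i) + rest i 0 - rest i (p i)"
    "rest i (p i) = 0 \<or> int (length (u @ X_word p x i)) + int (length ?vp) = 2 * half i (p i)"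
    unfolding X_word_def using prefix by blast+
  have row: "v @ T_row l k t p a x i = ?vp @ ?T"
    unfolding T_row_def by (subst concat_map_shift) simp
  have ln: "ln i (p i) = rest i (p i)" by (simp add: ln_eq)
  have T: "fill (half i (p i) + rest i (p i) div 2) (u @ X_word p x i) (?vp @ ?T)"
    "int (length ?T) = rest i (p i)"
    using fill_T_word[OF assms(1) order_refl vp(1,3)] ln by auto
  have len: "int (length (?vp @ ?T)) = int (tsum t p i) + bound i"
    using vp(2) T(2) assms(3,4) by (simp add: rest_0)
  have m: "2 * (half i (p i) + rest i (p i) div 2) = 2 * half i (p i) + rest i (p i)"
    using rest_even_nonneg[OF assms(1) order_refl] by (auto elim: evenE)
  have "2 * half i (p i) + rest i (p i) \<le> (if i < k then a (Suc i) - 1 else 2 * int n)"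
  proof (cases "rest i (p i) = 0")
    case True
    then show ?thesis using half_last[of i] half_end assms(1) by auto
  next
    case False
    \<comment> \<open>With something left to insert, no bracket is open, so the end of the row is
      read off from the lengths. It stays below \<open>A_(i+1)\<close> by
      \<open>bound i \<le> slack (Suc i)\<close>, or within \<open>2 * n\<close> by
      \<open>t + l \<le> 2 * n\<close> in the last row.\<close>
    then have "2 * half i (p i) + rest i (p i) = 2 * int (tsum t p i) + bound i"
      using vp(3) len T(2) assms(3) by simp
    moreover have "bound i \<le> slack (Suc i)" if "i < k"
      using bound_min[OF that] by simp
    ultimately show ?thesis
      using assms(1) tsum_le bound_last by (auto simp: slack_def le_less)
  qed
  then show ?thesis
    unfolding row m[symmetric] using T(1) len by blast
qed

lemma col_Suc: "col (Suc i) = (col i @ A_word t a (Suc i)) @ T_row l k t p a x (Suc i)"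
  by (simp add: col_def)

text \<open>\<open>m\<close> is only bounded, since empty dominoes may remain before the next
  interval or the end of the alphabet; they are skipped afterwards.\<close>

lemma fill_col:
  assumes "i \<le> k"
  shows "\<exists>m. fill m (a_word i t p a x) (col i) \<and>
    2 * m \<le> (if i < k then a (Suc i) - 1 else 2 * int n) \<and>
    int (length (col i)) = int (tsum t p i) + bound i"
  using assms
proof (induction i)
  case 0
  have "half 0 0 = 0" by (simp add: half_def xpos_def)
  then show ?case
    using fill_row[of 0 "[]" "[]"] fill.Nil
    by (simp add: col_def a_word_0 tsum_def prev_def)
next
  case (Suc i)
  then obtain m where m: "fill m (a_word i t p a x) (col i)" "2 * m \<le> a (Suc i) - 1"
    "int (length (col i)) = int (tsum t p i) + bound i"
    by auto
  let ?A = "A_word t a (Suc i)"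
  obtain c where c: "a (Suc i) = 2 * c + 1"
    using a_odd[of "Suc i"] Suc.prems by (auto elim: oddE)
  have half: "2 * half (Suc i) 0 = 2 * c + int (t (Suc i))"
    using half_0[OF Suc.prems] c by (simp add: xpos_def)
  then have A: "?A = [2 * c + 1..2 * half (Suc i) 0]"
    using c by (simp add: A_word_def algebra_simps)
  have "fill c (a_word i t p a x) (col i)"
    using fill_skips[OF m(1), of c] m(2) c by simp
  then have "fill (half (Suc i) 0) (a_word i t p a x @ ?A) (col i @ ?A)"
    unfolding A
  proof (rule fill_keeps)
    show "c \<le> half (Suc i) 0" using half by linarith
    \<comment> \<open>The dominoes of \<open>A_(i+1)\<close> need \<open>t (Suc i) div 2\<close>
      open brackets. Twice the number available is
      \<open>a (Suc i) - 1 - 2 * tsum t p i - bound i\<close>, so this inequality is exactly what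
      keeping them requires.\<close>
    have "bound i \<le> slack (Suc i)"
      using bound_min[of i] Suc.prems by simp
    then show "int (length (a_word i t p a x)) + int (length (col i)) + 2 * (half (Suc i) 0 - c) \<le> 2 * c"
      using m(3) c half by (simp add: length_a_word slack_def)
  qed
  from fill_row[OF Suc.prems this] show ?case
    using m(3) by (simp add: length_a_word tsum_Suc prev_def a_word_Suc col_Suc)
qed

lemma T_col_eq: "T_col l k t p a x = col k"
  by (simp add: T_col_def col_def)

lemma fill_T_col: "fill (int n) (a_word k t p a x) (T_col l k t p a x)"
  "length (T_col l k t p a x) = l"
proof -
  obtain m where m: "fill m (a_word k t p a x) (col k)" "2 * m \<le> 2 * int n"
    "int (length (col k)) = int (tsum t p k) + bound k"
    using fill_col[of k] by auto
  show "fill (int n) (a_word k t p a x) (T_col l k t p a x)"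
    using fill_skips[OF m(1)] m(2) by (simp add: T_col_eq)
  show "length (T_col l k t p a x) = l"
    using m(3) tsum_le(1) by (simp add: T_col_eq bound_last)
qed

end

theorem theorem7:
  fixes n l k tt :: nat
    and t p :: "nat \<Rightarrow> nat"
    and a :: "nat \<Rightarrow> int"
    and x :: "nat \<Rightarrow> nat \<Rightarrow> int"
    and w :: "int list"
  assumes "n \<ge> 1" and "l \<le> 2 * n"
    and "\<forall>j\<in>{1..k}. 0 < t j \<and> even (t j)"
    and "tt = (\<Sum>j=0..k. p j) + (\<Sum>j=1..k. t j)"
    and "tt \<in> {1..n}" and "tt \<le> min l (2 * n - l)" and "even (l - tt)"
    and "w = a_word k t p a x" and "w \<in> SpT (2 * n) tt"
    and "parity_inv ` (\<Union>i\<in>{0..k}. set (X_word p x i)) \<inter> set w = {}"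
    and "\<forall>i\<in>{1..k}. odd (a i)"
    and "max_stable_intervals (set w) = (\<lambda>i. set (A_word t a i)) ` {1..k}"
    and "\<forall>i\<in>{1..k}. a i \<ge> 2 * int (tsum t p (i - 1)) + int (t i) + 1"
  shows "(\<forall>i\<in>{0..k}. 0 \<le> ltil l k t p a x i \<and> even (ltil l k t p a x i)
            \<and> (\<forall>j\<in>{0..p i}. 0 \<le> len l k t p a x i j \<and> even (len l k t p a x i j)))
         \<and> T_col l k t p a x \<in> SST (2 * n) l
         \<and> red (T_col l k t p a x) = w
         \<and> (\<forall>b\<in>SST (2 * n) l. red b = w \<longrightarrow> b = T_col l k t p a x)"
proof -
  have tt: "tt = tsum t p k"
    using assms(4) by (simp add: tsum_def)
  interpret column_data l k n t p a x
  proof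
    show "sorted_wrt (<) (a_word k t p a x)" "set (a_word k t p a x) \<subseteq> {1..2 * int n}"
      using assms(8,9) by (auto simp: SpT_def SST_def)
    show "parity_inv (x i j) \<notin> set (a_word k t p a x)" if "i \<le> k" "0 < j" "j \<le> p i" for i j
    proof -
      have "x i j \<in> set (X_word p x i)"
        using that by (auto simp: set_X_word)
      then show ?thesis
        using assms(8,10) that(1) by fastforce
    qed
  qed (use assms tt in auto)
  show ?thesis
  proof (intro conjI ballI impI)
    fix i assume i: "i \<in> {0..k}"
    then show "0 \<le> ltil l k t p a x i" "even (ltil l k t p a x i)"
      using rest_even_nonneg[of i 0] by (auto simp: rest_def)
    fix j assume "j \<in> {0..p i}"
    with i show "0 \<le> len l k t p a x i j" "even (len l k t p a x i j)"
      using ln_even_nonneg by auto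
  next
    show "T_col l k t p a x \<in> SST (2 * n) l"
      using fill_T_col fill_invariants(5,6)[OF fill_T_col(1)] by (simp add: SST_def)
    show "red (T_col l k t p a x) = w"
      using fill_rem_set[OF fill_T_col(1)] assms(8) by simp
    fix b assume "b \<in> SST (2 * n) l" "red b = w"
    \<comment> \<open>Any preimage of \<open>w\<close> is again related to \<open>w\<close> by
      \<open>fill\<close>, so equal length forces it to be \<open>T_col\<close>.\<close>
    then have "fill (int n) w b" "length b = l"
      using fill_red[of b n] by (auto simp: SST_def)
    then show "b = T_col l k t p a x"
      using fill_T_col assms(8) fill_unique by metis
  qed
qed

end
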